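(* Let $n\in\mathbb N$ be arbitrary, let $\mathbf{\Gamma}_0$ be the GKSL operator on $\mathbb C^{n\times n}$ generated by the single matrix $V=\sigma_+ = \sum_{k=1}^{n-1}\sqrt{k(n-k)}\,e_ke_{k+1}^T$, and let $B_0=B_0(\mathbf{\Gamma}_0)\in\mathbb R^{n\times n}$ be its matrix representation on diagonal matrices. Let $\Lambda_0$ be the toy model on $\Delta^{n-1}$ with dissipative generator $B_0$. Then for every initial state $x_0\in\Delta^{n-1}$, $$\overline{\mathfrak{reach}_{\Lambda_0}(x_0)}=\Delta^{n-1}.$$
   Context: $\Delta^{n-1}=\{x\in\mathbb R^n : x_i\ge 0 \text{ for all } i,\ \sum_{i=1}^n x_i=1\}$ is the standard simplex and $(e_k)_{k=1}^n$ is the standard basis. GKSL operator: given matrices $V_1,\dots,V_r\in\mathbb C^{n\times n}$, the GKSL operator generated by them is the linear map on $\mathbb C^{n\times n}$ $$\mathbf{\Gamma}(\rho)=\sum_k\Big(\tfrac12\big(V_k^\dagger V_k\rho+\rho V_k^\dagger V_k\big)-V_k\rho V_k^\dagger\Big).$$ If $\mathbf{\Gamma}$ maps diagonal matrices to diagonal matrices (as is the case here), $B_0(\mathbf{\Gamma})$ denotes the matrix determined by $\operatorname{diag}(B_0(\mathbf{\Gamma})x)=\mathbf{\Gamma}(\operatorname{diag}(x))$ for all vectors $x$. Toy model: given $B_0\in\mathbb R^{n\times n}$ such that $e^{-tB_0}$ leaves $\Delta^{n-1}$ invariant for all $t\ge0$, the toy model $\Lambda$ with dissipative generator $B_0$ is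 the hybrid control system $$\dot x(t)=-B_0x(t),\ x(t_k)=x_k,\ t\in[t_k,t_{k+1});\qquad x_0\in\Delta^{n-1},\ x_{k+1}=\pi_k e^{-(t_{k+1}-t_k)B_0}x_k,\ k\ge0,$$ whose controls are the switching times $0=t_0\le t_1\le t_2\le\dots$ (not accumulating on finite intervals) and the $n\times n$ permutation matrices $\pi_k$. Its reachable set $\mathfrak{reach}_\Lambda(x_0)=\{x(t): x(\cdot)\text{ a solution},\,t\ge0\}$ equals $\mathcal S_\Lambda x_0$, where $\mathcal S_\Lambda\subset\mathbb R^{n\times n}$ is the matrix semigroup generated by $\{e^{-tB_0}: t\ge0\}$ and all $n\times n$ permutation matrices. *)

theory Defs
  imports "HOL-Analysis.Analysis"
begin

text \<open>
  Vectors and matrices of size \<open>n\<close> are indexed by a finite linearly ordered type of cardinality \<open>n\<close>.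
  The order serves only to number coordinates: \<open>idx k\<close> is the \<open>k\<close>-th smallest index,
  meaningful for \<open>1 \<le> k \<le> n\<close>.
\<close>

definition idx :: "nat \<Rightarrow> 'n::{finite,linorder}" where
  "idx k = sorted_list_of_set (UNIV :: 'n set) ! (k - 1)"

definition std_basis :: "nat \<Rightarrow> 'a::zero_neq_one ^ 'n::{finite,linorder}" where
  "std_basis k = axis (idx k) 1"

definition std_simplex :: "(real ^ 'n::finite) set" where
  "std_simplex = {x. (\<forall>i. 0 \<le> x $ i) \<and> (\<Sum>i\<in>UNIV. x $ i) = 1}"

definition diag_mat :: "'a::zero ^ 'n \<Rightarrow> 'a ^ 'n ^ 'n" where
  "diag_mat x = (\<chi> i j. if i = j then x $ i else 0)"

definition dagger :: "complex ^ 'n ^ 'm \<Rightarrow> complex ^ 'm ^ 'n" where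
  "dagger A = (\<chi> i j. cnj (A $ j $ i))"

definition gksl :: "(complex ^ 'n::finite ^ 'n) list \<Rightarrow> complex ^ 'n ^ 'n \<Rightarrow> complex ^ 'n ^ 'n" where
  "gksl Vs \<rho> = (\<Sum>V\<leftarrow>Vs. (1/2) *\<^sub>R (dagger V ** V ** \<rho> + \<rho> ** dagger V ** V) - V ** \<rho> ** dagger V)"

text \<open>
  Definite description: only meaningful for an operator that acts on diagonal matrices through
  a (then unique) real matrix.
\<close>

definition diag_rep ::
    "(complex ^ 'n::finite ^ 'n \<Rightarrow> complex ^ 'n ^ 'n) \<Rightarrow> real ^ 'n ^ 'n" where
  "diag_rep \<Gamma> = (THE B. \<forall>x :: complex ^ 'n.
     diag_mat (map_matrix complex_of_real B *v x) = \<Gamma> (diag_mat x))"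

definition sigma_plus :: "complex ^ 'n::{finite,linorder} ^ 'n::{finite,linorder}" where
  "sigma_plus = (\<Sum>k = 1..CARD('n) - 1.
     sqrt (real k * (real CARD('n) - real k)) *\<^sub>R
       (columnvector (std_basis k) ** (rowvector (std_basis (k + 1)) :: complex ^ 'n::{finite,linorder} ^ 1)))"

text \<open>
  The library's multiplication on \<open>real ^ 'n ^ 'n\<close> is entrywise, hence so are its powers and
  \<open>exp\<close> is unavailable; the exponential series is taken with respect to the matrix product.
\<close>

definition mat_power :: "real ^ 'n::finite ^ 'n \<Rightarrow> nat \<Rightarrow> real ^ 'n ^ 'n" where
  "mat_power A k = (((**) A) ^^ k) (mat 1)"

definition mat_exp :: "real ^ 'n::finite ^ 'n \<Rightarrow> real ^ 'n ^ 'n" where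
  "mat_exp A = (\<Sum>k. (1 / fact k) *\<^sub>R mat_power A k)"

definition permutation_matrix :: "real ^ 'n::finite ^ 'n \<Rightarrow> bool" where
  "permutation_matrix P \<longleftrightarrow>
     (\<exists>p. p permutes UNIV \<and> P = (\<chi> i j. if i = p j then 1 else 0))"

definition switching_times :: "(nat \<Rightarrow> real) \<Rightarrow> bool" where
  "switching_times t \<longleftrightarrow> t 0 = 0 \<and> mono t \<and> (\<forall>T. finite {k. t k \<le> T})"

text \<open>
  Switching times may coincide. On an empty interval \<open>[t\<^sub>k, t\<^sub>k\<^sub>+\<^sub>1)\<close> neither the differential equation
  nor the initial condition constrains the trajectory, but \<open>\<pi>\<^sub>k\<close> still acts on the states \<open>\<xi>\<close>.
\<close>

definition toy_solution ::
    "real ^ 'n::finite ^ 'n \<Rightarrow> real ^ 'n \<Rightarrow> (nat \<Rightarrow> real) \<Rightarrow> (nat \<Rightarrow> real ^ 'n ^ 'n) \<Rightarrow>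
     (real \<Rightarrow> real ^ 'n) \<Rightarrow> bool" where
  "toy_solution B x\<^sub>0 t \<pi> x \<longleftrightarrow>
     switching_times t \<and> (\<forall>k. permutation_matrix (\<pi> k)) \<and>
     (\<exists>\<xi> :: nat \<Rightarrow> real ^ 'n. \<xi> 0 = x\<^sub>0 \<and>
        (\<forall>k. \<xi> (Suc k) = \<pi> k *v (mat_exp (- ((t (Suc k) - t k) *\<^sub>R B)) *v \<xi> k)) \<and>
        (\<forall>k. t k < t (Suc k) \<longrightarrow> x (t k) = \<xi> k \<and>
           (\<forall>s\<in>{t k..<t (Suc k)}.
              (x has_vector_derivative - (B *v x s)) (at s within {t k..<t (Suc k)}))))"

definition toy_reach :: "real ^ 'n::finite ^ 'n \<Rightarrow> real ^ 'n \<Rightarrow> (real ^ 'n) set" where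
  "toy_reach B x\<^sub>0 = {x s | x s t \<pi>. toy_solution B x\<^sub>0 t \<pi> x \<and> 0 \<le> s}"

end

theory Submission
  imports Defs
begin

text \<open>
  On diagonal matrices the generator is a chain that moves mass from level \<open>k + 1\<close> down to level \<open>k\<close>
  at rate \<open>k (n - k)\<close>. Forward in time the mean height decays at least like \<open>e\<^sup>-\<^sup>t\<close>, so every state
  is driven to \<open>e\<^sub>1\<close>. Conversely \<open>e\<^sub>1\<close> can be steered exactly to every state: permute the target so that
  its support is \<open>{1..m}\<close> and run the flow backwards. The span of the first \<open>m\<close> levels is invariant
  and the mass at level \<open>m\<close> grows exponentially while the total mass stays 1, so the trajectory must
  leave the simplex. When it does, a further coordinate vanishes; induct on the size of the support.
  Continuity of the exact steering combines the two halves.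
\<close>

section \<open>The generator on diagonal matrices\<close>

lemma bij_betw_idx:
  "bij_betw (idx :: nat \<Rightarrow> 'n::{finite,linorder}) {1..CARD('n)} UNIV"
proof -
  let ?xs = "sorted_list_of_set (UNIV :: 'n set)"
  have "bij_betw (\<lambda>k. k - 1) {1..CARD('n)} {..<CARD('n)}"
    by (rule bij_betw_byWitness[where f' = Suc]) auto
  moreover have "bij_betw ((!) ?xs) {..<CARD('n)} UNIV"
    by (rule bij_betw_nth) auto
  ultimately show ?thesis
    using bij_betw_trans[of "\<lambda>k. k - 1" _ _ "(!) ?xs"] by (simp add: idx_def[abs_def] comp_def)
qed

lemma idx_cases:
  obtains k where "k \<in> {1..CARD('n)}" "(i::'n::{finite,linorder}) = idx k"
proof -
  have "i \<in> idx ` {1..CARD('n)}"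
    using bij_betw_idx[where 'n='n] by (simp add: bij_betw_def)
  then show thesis using that by blast
qed

lemma idx_eq_iff:
  assumes "j \<in> {1..CARD('n)}" "k \<in> {1..CARD('n)}"
  shows "(idx j :: 'n::{finite,linorder}) = idx k \<longleftrightarrow> j = k"
  using bij_betw_imp_inj_on[OF bij_betw_idx] assms by (rule inj_on_eq_iff)

lemma sum_UNIV_idx: "(\<Sum>i\<in>(UNIV::'n::{finite,linorder} set). f i) = (\<Sum>k=1..CARD('n). f (idx k))"
  using sum.reindex_bij_betw[OF bij_betw_idx, of f] by simp

definition pos :: "'n::{finite,linorder} \<Rightarrow> nat" where
  "pos = inv_into {1..CARD('n)} idx"

lemma pos_idx: "k \<in> {1..CARD('n)} \<Longrightarrow> pos (idx k :: 'n::{finite,linorder}) = k"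
  unfolding pos_def by (intro inv_into_f_f bij_betw_imp_inj_on[OF bij_betw_idx])

text \<open>The squared coefficients of \<open>sigma_plus\<close>. They vanish at both ends of the
  chain, which absorbs the boundary cases of later index shifts.\<close>

definition rate :: "nat \<Rightarrow> nat \<Rightarrow> real" where
  "rate n k = real k * (real n - real k)"

lemma rate_0 [simp]: "rate n 0 = 0" and rate_self [simp]: "rate n n = 0"
  by (simp_all add: rate_def)

lemma rate_nonneg: "k \<le> n \<Longrightarrow> 0 \<le> rate n k"
  by (simp add: rate_def)

text \<open>The factor \<open>n - k\<close> is at least 1. This is the source of the decay rate 1 of
  the mean height.\<close>

lemma rate_ge: "k < n \<Longrightarrow> real k \<le> rate n k"
  by (simp add: rate_def mult_le_cancel_left1)

text \<open>The negative is the rate matrix of a pure death process acting on column vectors; the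
  lowest level is absorbing because \<open>rate n 0 = 0\<close>.\<close>

definition ladder_gen :: "real ^ 'n::{finite,linorder} ^ 'n::{finite,linorder}" where
  "ladder_gen = (\<chi> i j. if i = j then rate CARD('n) (pos i - 1)
     else if pos j = Suc (pos i) then - rate CARD('n) (pos i) else 0)"

text \<open>
  The index \<open>Suc CARD('n)\<close> produces a junk coordinate, which is harmless as \<open>rate n n = 0\<close>.
\<close>

lemma sum_shift:
  fixes f :: "nat \<Rightarrow> 'a::real_vector"
  assumes "k \<in> {1..n}"
  shows "(\<Sum>j=1..n. if j = Suc k then rate n k *\<^sub>R f j else 0) = rate n k *\<^sub>R f (Suc k)"
proof (cases "k = n")
  case False
  with assms have "Suc k \<in> {1..n}" by auto
  then show ?thesis by (simp add: sum.delta)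
qed (auto intro!: sum.neutral)

lemma ladder_gen_mult_nth:
  assumes "k \<in> {1..CARD('n)}"
  shows "(ladder_gen *v x) $ (idx k :: 'n::{finite,linorder}) =
    rate CARD('n) (k - 1) * x $ idx k - rate CARD('n) k * x $ idx (Suc k)"
proof -
  let ?n = "CARD('n)"
  have "(ladder_gen *v x) $ (idx k :: 'n) = (\<Sum>j=1..?n. ladder_gen $ (idx k :: 'n) $ idx j * x $ idx j)"
    by (simp add: matrix_vector_mult_def sum_UNIV_idx)
  also have "\<dots> = (\<Sum>j=1..?n. (if j = k then rate ?n (k - 1) * x $ idx j else 0)
      - (if j = Suc k then rate ?n k *\<^sub>R x $ idx j else 0))"
    using assms by (intro sum.cong refl) (auto simp: ladder_gen_def idx_eq_iff pos_idx)
  also have "\<dots> = rate ?n (k - 1) * x $ idx k - rate ?n k * x $ idx (Suc k)"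
    unfolding sum_subtractf sum_shift[OF assms] using assms by (simp add: sum.delta)
  finally show ?thesis .
qed

text \<open>Summation by parts, moving the generator onto the weights. Constant weights will give
  conservation of mass, the weights \<open>k - 1\<close> decay of the mean height.\<close>

lemma sum_ladder_gen:
  fixes x :: "real ^ 'n::{finite,linorder}"
  shows "(\<Sum>k=1..CARD('n). w k * (ladder_gen *v x) $ idx k) =
    (\<Sum>k=1..CARD('n). (w k - w (k - 1)) * rate CARD('n) (k - 1) * x $ idx k)"
proof -
  let ?n = "CARD('n)"
  \<comment> \<open>The weighted flow from level \<open>k + 1\<close> into level \<open>k\<close>.
    Its differences telescope to \<open>g ?n - g 0\<close>, which is 0 because \<open>rate\<close>
    vanishes at 0 and at \<open>?n\<close>.\<close>
  define g where "g k = w k * rate ?n k * x $ idx (Suc k)" for k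
  have "(\<Sum>k=1..?n. w k * (ladder_gen *v x) $ idx k) =
      (\<Sum>k=1..?n. (w k - w (k - 1)) * rate ?n (k - 1) * x $ idx k - (g k - g (k - 1)))"
    by (intro sum.cong refl) (auto simp: ladder_gen_mult_nth g_def algebra_simps)
  also have "(\<Sum>k=1..?n. g k - g (k - 1)) = g ?n - g 0"
    using sum_telescope''[of 0 ?n g] by simp
  then have "(\<Sum>k=1..?n. g k - g (k - 1)) = 0"
    by (simp add: g_def)
  then have "(\<Sum>k=1..?n. (w k - w (k - 1)) * rate ?n (k - 1) * x $ idx k - (g k - g (k - 1))) =
     (\<Sum>k=1..?n. (w k - w (k - 1)) * rate ?n (k - 1) * x $ idx k)"
    by (simp add: sum_subtractf)
  finally show ?thesis .
qed

section \<open>Entries of the GKSL operator generated by \<open>sigma_plus\<close>\<close>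

lemma sigma_plus_nth:
  assumes "i \<in> {1..CARD('n)}" "j \<in> {1..CARD('n)}"
  shows "(sigma_plus :: complex ^ 'n::{finite,linorder} ^ 'n::{finite,linorder}) $ idx i $ idx j =
    (if j = Suc i then complex_of_real (sqrt (rate CARD('n) i)) else 0)"
proof -
  let ?n = "CARD('n)"
  have "(sigma_plus :: complex ^ 'n::{finite,linorder} ^ 'n::{finite,linorder}) $ idx i $ idx j =
    (\<Sum>k=1..?n - 1. if k = i then if j = Suc i then complex_of_real (sqrt (rate ?n i)) else 0 else 0)"
    unfolding sigma_plus_def sum_component vector_scaleR_component
    using assms
    by (intro sum.cong refl)
      (auto simp: columnvector_def rowvector_def std_basis_def matrix_matrix_mult_def axis_def
         idx_eq_iff rate_def of_real_def)
  also have "\<dots> = (if j = Suc i then complex_of_real (sqrt (rate ?n i)) else 0)"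
    using assms by (auto simp: sum.delta)
  finally show ?thesis .
qed

lemma mult_diag_mat_nth: "((A::'a::comm_semiring_1 ^ 'n::finite ^ 'm) ** diag_mat x) $ i $ j = A $ i $ j * x $ j"
  by (simp add: matrix_matrix_mult_def diag_mat_def if_distrib[of "\<lambda>t. _ * t"] cong: if_cong)

lemma diag_mat_mult_nth: "(diag_mat x ** (A::'a::comm_semiring_1 ^ 'n::finite ^ 'm::finite)) $ i $ j = x $ i * A $ i $ j"
  by (simp add: matrix_matrix_mult_def diag_mat_def if_distrib[of "\<lambda>t. t * _"] cong: if_cong)

text \<open>Distinct columns of \<open>sigma_plus\<close> have their nonzero entries in distinct
  rows, so the product is diagonal.\<close>

lemma dagger_sigma_plus_mult_nth:
  assumes "i \<in> {1..CARD('n)}" "j \<in> {1..CARD('n)}"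
  shows "(dagger sigma_plus ** (sigma_plus :: complex ^ 'n::{finite,linorder} ^ 'n::{finite,linorder})) $ idx i $ idx j =
    (if i = j then complex_of_real (rate CARD('n) (i - 1)) else 0)"
proof -
  let ?n = "CARD('n)"
  have "(dagger sigma_plus ** (sigma_plus :: complex ^ 'n::{finite,linorder} ^ 'n::{finite,linorder})) $ idx i $ idx j =
    (\<Sum>k=1..?n. if k = i - 1 then if i = j then complex_of_real (rate ?n (i - 1)) else 0 else 0)"
    unfolding matrix_matrix_mult_def dagger_def vec_lambda_beta sum_UNIV_idx
    using assms
    by (intro sum.cong refl) (auto simp: sigma_plus_nth rate_nonneg simp flip: of_real_mult)
  \<comment> \<open>For \<open>i = 1\<close> the index \<open>i - 1\<close> lies outside the range
    of summation; the sum is then 0, in agreement with \<open>rate ?n 0 = 0\<close>.\<close>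
  also have "\<dots> = (if i = j then complex_of_real (rate ?n (i - 1)) else 0)"
    using assms by (auto simp: sum.delta dest: le_SucI)
  finally show ?thesis .
qed

lemma sigma_plus_diag_nth:
  assumes "i \<in> {1..CARD('n)}" "j \<in> {1..CARD('n)}"
  shows "((sigma_plus :: complex ^ 'n::{finite,linorder} ^ 'n::{finite,linorder}) ** diag_mat x ** dagger sigma_plus)
      $ idx i $ idx j =
    (if i = j then rate CARD('n) i *\<^sub>R x $ idx (Suc i) else 0)"
proof -
  let ?n = "CARD('n)"
  have "((sigma_plus :: complex ^ 'n::{finite,linorder} ^ 'n::{finite,linorder}) ** diag_mat x ** dagger sigma_plus) $ idx i $ idx j =
    (\<Sum>k=1..?n. (sigma_plus ** diag_mat x) $ (idx i :: 'n) $ idx k * cnj (sigma_plus $ (idx j :: 'n) $ idx k))"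
    unfolding matrix_matrix_mult_def[of "sigma_plus ** diag_mat x"] vec_lambda_beta sum_UNIV_idx
    by (simp add: dagger_def)
  also have "\<dots> = (\<Sum>k=1..?n. if i = j then if k = Suc i then rate ?n i *\<^sub>R x $ idx k else 0 else 0)"
    using assms
    by (auto simp: mult_diag_mat_nth sigma_plus_nth rate_nonneg scaleR_conv_of_real simp flip: of_real_mult
        intro!: sum.cong)
  also have "\<dots> = (if i = j then rate ?n i *\<^sub>R x $ idx (Suc i) else 0)"
    using sum_shift[OF assms(1), of "\<lambda>k. x $ idx k"] by (auto simp del: sum.delta)
  finally show ?thesis .
qed

text \<open>As \<open>dagger V ** V\<close> is diagonal, the two halves of the anticommutator
  coincide on diagonal matrices and give the loss term; \<open>V ** \<rho> ** dagger V\<close> is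
  the gain from the level above.\<close>

lemma gksl_sigma_plus_diag_mat:
  fixes x :: "complex ^ 'n::{finite,linorder}"
  shows "gksl [sigma_plus] (diag_mat x) = diag_mat (map_matrix complex_of_real ladder_gen *v x)"
proof -
  let ?n = "CARD('n)"
  have "gksl [sigma_plus] (diag_mat x) $ idx i $ idx j =
      diag_mat (map_matrix complex_of_real ladder_gen *v x) $ idx i $ idx j"
    if ij: "i \<in> {1..?n}" "j \<in> {1..?n}" for i j
  proof -
    have "(map_matrix complex_of_real ladder_gen *v x) $ (idx i :: 'n) =
       (\<Sum>k=1..?n. (if k = i then rate ?n (i - 1) *\<^sub>R x $ idx k else 0)
         - (if k = Suc i then rate ?n i *\<^sub>R x $ idx k else 0))"
      using ij
      by (auto simp: map_matrix_def matrix_vector_mult_def sum_UNIV_idx ladder_gen_def idx_eq_iff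
          pos_idx scaleR_conv_of_real intro!: sum.cong)
    also have "\<dots> = rate ?n (i - 1) *\<^sub>R x $ idx i - rate ?n i *\<^sub>R x $ idx (Suc i)"
      unfolding sum_subtractf sum_shift[OF ij(1)] using ij by (simp add: sum.delta)
    finally have rhs: "(map_matrix complex_of_real ladder_gen *v x) $ (idx i :: 'n) = \<dots>" .
    have "gksl [sigma_plus] (diag_mat x) $ idx i $ idx j =
      (1/2) *\<^sub>R ((dagger sigma_plus ** sigma_plus) $ (idx i :: 'n) $ idx j * x $ idx j
        + x $ idx i * (dagger sigma_plus ** sigma_plus) $ (idx i :: 'n) $ idx j)
      - (sigma_plus ** diag_mat x ** dagger sigma_plus) $ (idx i :: 'n) $ idx j"
      by (simp add: gksl_def mult_diag_mat_nth diag_mat_mult_nth flip: matrix_mul_assoc[of "diag_mat x"])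
    moreover have "diag_mat y $ (idx i :: 'n) $ idx j = (if i = j then y $ idx i else 0)"
      for y :: "complex ^ 'n::{finite,linorder}"
      using ij by (simp add: diag_mat_def idx_eq_iff)
    ultimately show ?thesis
      using ij rhs
      by (auto simp: dagger_sigma_plus_mult_nth sigma_plus_diag_nth scaleR_conv_of_real)
  qed
  then show ?thesis
    by (metis idx_cases vec_eq_iff)
qed

text \<open>Uniqueness for the definite description: the diagonal of the image of
  \<open>axis j 1\<close> is column \<open>j\<close> of the representing matrix.\<close>

lemma diag_rep_eqI:
  assumes "\<And>x. \<Gamma> (diag_mat x) = diag_mat (map_matrix complex_of_real B *v x)"
  shows "diag_rep \<Gamma> = B"
  unfolding diag_rep_def
proof (rule the_equality)
  fix C
  assume C: "\<forall>x. diag_mat (map_matrix complex_of_real C *v x) = \<Gamma> (diag_mat x)"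
  have "diag_mat (map_matrix complex_of_real C *v axis j 1) $ i $ i
      = diag_mat (map_matrix complex_of_real B *v axis j 1) $ i $ i" for i j
    using C assms by simp
  then have "C $ i $ j = B $ i $ j" for i j
    by (simp add: diag_mat_def map_matrix_def matrix_vector_mult_def axis_def if_distrib[of "\<lambda>t. _ * t"]
        cong: if_cong)
  then show "C = B"
    by (simp add: vec_eq_iff)
qed (simp add: assms)

section \<open>Linear flows and the matrix exponential\<close>

text \<open>Mean value theorem for \<open>u\<close> times an integrating factor. A single value of
  \<open>g\<close> replaces the integral in the Duhamel formula, which suffices for estimates by the
  sign of \<open>g\<close>.\<close>

lemma scalar_variation_of_constants:
  fixes u :: "real \<Rightarrow> real"
  assumes "a \<le> b"
    and deriv: "\<And>s. s \<in> {a..b} \<Longrightarrow> (u has_real_derivative c * u s + g s) (at s within {a..b})"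
  shows "\<exists>s\<in>{a..b}. u b = exp (c * (b - a)) * u a + exp (c * (b - s)) * g s * (b - a)"
proof -
  \<comment> \<open>The factor equals 1 at \<open>b\<close>, so \<open>v b = u b\<close>.\<close>
  define v where "v s = exp (- c * (s - b)) * u s" for s
  have "(v has_real_derivative exp (- c * (s - b)) * g s) (at s within {a..b})"
    if "s \<in> {a..b}" for s
    unfolding v_def using deriv[OF that]
    by (auto intro!: derivative_eq_intros simp: algebra_simps)
  then have "(v has_derivative (*) (exp (- c * (s - b)) * g s)) (at s within {a..b})"
    if "a \<le> s" "s \<le> b" for s
    using that by (simp add: has_field_derivative_def)
  from mvt_very_simple[OF \<open>a \<le> b\<close> this]
  obtain s where s: "s \<in> {a..b}" "v b - v a = exp (- c * (s - b)) * g s * (b - a)"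
    by blast
  then have "u b = exp (c * (b - a)) * u a + exp (c * (b - s)) * g s * (b - a)"
    by (simp add: v_def algebra_simps)
  with s show ?thesis by blast
qed

lemma scalar_ode_ge:
  fixes u :: "real \<Rightarrow> real"
  assumes "a \<le> b"
    and "\<And>s. s \<in> {a..b} \<Longrightarrow> (u has_real_derivative c * u s + g s) (at s within {a..b})"
    and "\<And>s. s \<in> {a..b} \<Longrightarrow> 0 \<le> g s"
  shows "exp (c * (b - a)) * u a \<le> u b"
  using scalar_variation_of_constants[of a b u c g] assms by auto

lemma scalar_ode_eq:
  fixes u :: "real \<Rightarrow> real"
  assumes "a \<le> b"
    and "\<And>s. s \<in> {a..b} \<Longrightarrow> (u has_real_derivative c * u s) (at s within {a..b})"
  shows "u b = exp (c * (b - a)) * u a"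
  using scalar_variation_of_constants[of a b u c "\<lambda>_. 0"] assms by simp

section \<open>The matrix exponential as a power series\<close>

lemma matrix_mult_bounded_bilinear:
  "bounded_bilinear ((**) :: real^'n::finite^'m::finite \<Rightarrow> real^'p::finite^'n \<Rightarrow> real^'p^'m)"
  unfolding bilinear_conv_bounded_bilinear[symmetric] bilinear_def
  by (auto intro!: linearI simp: vec_eq_iff matrix_matrix_mult_def sum.distrib sum_distrib_left
      algebra_simps)

lemma mat_power_0 [simp]: "mat_power A 0 = mat 1"
  and mat_power_Suc [simp]: "mat_power A (Suc k) = A ** mat_power A k"
  by (simp_all add: mat_power_def)

lemma mat_power_scaleR: "mat_power (c *\<^sub>R A) k = c ^ k *\<^sub>R mat_power A k"
proof (induction k)
  case (Suc k)
  then show ?case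
    using bounded_bilinear.scaleR_left[OF matrix_mult_bounded_bilinear]
      bounded_bilinear.scaleR_right[OF matrix_mult_bounded_bilinear]
    by (metis (no_types, lifting) mat_power_Suc power_Suc scaleR_scaleR)
qed simp

text \<open>Comparison with a scalar exponential series, the norm being submultiplicative up to a
  constant factor \<open>K\<close>.\<close>

lemma summable_mat_exp: "summable (\<lambda>k. (1 / fact k) *\<^sub>R mat_power (A :: real^'n::finite^'n) k)"
proof -
  obtain K where K: "\<And>(X :: real^'n^'n) (Y :: real^'n^'n). norm (X ** Y) \<le> norm X * norm Y * K"
    using bounded_bilinear.bounded[OF matrix_mult_bounded_bilinear] by blast
  have le: "norm (mat_power A k) \<le> (norm A * \<bar>K\<bar>) ^ k * norm (mat 1 :: real^'n^'n)" for k
  proof (induction k)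
    case (Suc k)
    have "norm (mat_power A (Suc k)) \<le> norm A * norm (mat_power A k) * K"
      using K by simp
    also have "\<dots> \<le> (norm A * \<bar>K\<bar>) * norm (mat_power A k)"
      using mult_left_mono[OF abs_ge_self, of "norm A * norm (mat_power A k)" K] by (simp add: mult_ac)
    also have "\<dots> \<le> (norm A * \<bar>K\<bar>) * ((norm A * \<bar>K\<bar>) ^ k * norm (mat 1 :: real^'n^'n))"
      by (intro mult_left_mono Suc) auto
    finally show ?case by (simp add: mult_ac)
  qed simp
  have "summable (\<lambda>k. inverse (fact k) * (norm A * \<bar>K\<bar>) ^ k * norm (mat 1 :: real^'n^'n))"
    by (intro summable_mult2 summable_exp)
  then show ?thesis
    using le by (rule_tac summable_comparison_test')
      (auto simp: field_simps divide_le_cancel)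
qed

lemma mat_exp_0 [simp]: "mat_exp (0 :: real^'n::finite^'n) = mat 1"
proof -
  have "(\<lambda>k. (1 / fact k) *\<^sub>R mat_power (0 :: real^'n^'n) k) = (\<lambda>k. if k = 0 then mat 1 else 0)"
  proof
    show "(1 / fact k) *\<^sub>R mat_power (0 :: real^'n^'n) k = (if k = 0 then mat 1 else 0)" for k
      by (cases k) (simp_all add: bounded_bilinear.zero_left[OF matrix_mult_bounded_bilinear])
  qed
  then show ?thesis
    unfolding mat_exp_def by (simp only: sums_unique[OF sums_single, symmetric])
qed

text \<open>Makes each coordinate of the flow a scalar power series in \<open>t\<close>, open to
  termwise differentiation.\<close>

lemma mat_exp_mult_nth_sums:
  fixes A :: "real ^ 'n::finite ^ 'n"
  shows "(\<lambda>k. ((mat_power A k *v v) $ i / fact k) * t ^ k) sums ((mat_exp (t *\<^sub>R A) *v v) $ i)"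
proof -
  have "bounded_linear (\<lambda>X :: real^'n^'n. (X *v v) $ i)"
    unfolding linear_conv_bounded_linear[symmetric]
    by (rule linearI)
      (simp_all add: matrix_vector_mult_def sum.distrib sum_distrib_left algebra_simps)
  from bounded_linear.sums[OF this summable_sums[OF summable_mat_exp[of "t *\<^sub>R A"]]]
  show ?thesis
    by (simp add: mat_power_scaleR mat_exp_def mult_ac flip: scaleR_matrix_vector_assoc)
qed

text \<open>The factor \<open>k + 1\<close> in \<open>diffs\<close> cancels against the factorial
  and leaves one more power of \<open>A\<close>, which is pulled out on the left.\<close>

lemma mat_exp_mult_nth_deriv:
  "((\<lambda>t. (mat_exp (t *\<^sub>R A) *v v) $ i) has_real_derivative
     (A *v (mat_exp (t *\<^sub>R A) *v v)) $ i) (at t)"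
proof -
  define c where "c k = (mat_power A k *v v) $ i / fact k" for k
  have eq: "(\<lambda>t. (mat_exp (t *\<^sub>R A) *v v) $ i) = (\<lambda>t. \<Sum>k. c k * t ^ k)"
    unfolding c_def by (intro ext sums_unique mat_exp_mult_nth_sums)
  have "summable (\<lambda>k. c k * t ^ k)" for t
    unfolding c_def using mat_exp_mult_nth_sums by (rule sums_summable)
  then have d: "((\<lambda>t. \<Sum>k. c k * t ^ k) has_real_derivative (\<Sum>k. diffs c k * t ^ k)) (at t)"
    by (rule termdiffs_strong_converges_everywhere)
  have "(\<lambda>k. \<Sum>j\<in>UNIV. A $ i $ j * (((mat_power A k *v v) $ j / fact k) * t ^ k)) sums
     (\<Sum>j\<in>UNIV. A $ i $ j * (mat_exp (t *\<^sub>R A) *v v) $ j)"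
    by (intro sums_sum sums_mult mat_exp_mult_nth_sums)
  also have "(\<Sum>j\<in>UNIV. A $ i $ j * (mat_exp (t *\<^sub>R A) *v v) $ j) = (A *v (mat_exp (t *\<^sub>R A) *v v)) $ i"
    by (simp add: matrix_vector_mult_def)
  also have "(\<lambda>k. \<Sum>j\<in>UNIV. A $ i $ j * (((mat_power A k *v v) $ j / fact k) * t ^ k)) =
     (\<lambda>k. diffs c k * t ^ k)"
  proof
    fix k
    have "(mat_power A (Suc k) *v v) $ i = (\<Sum>j\<in>UNIV. A $ i $ j * (mat_power A k *v v) $ j)"
      unfolding mat_power_Suc matrix_vector_mul_assoc[symmetric]
      by (simp add: matrix_vector_mult_def)
    moreover have "diffs c k = (mat_power A (Suc k) *v v) $ i / fact k"
      by (simp add: diffs_def c_def fact_Suc del: of_nat_Suc mat_power_Suc)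
    ultimately show "(\<Sum>j\<in>UNIV. A $ i $ j * (((mat_power A k *v v) $ j / fact k) * t ^ k)) = diffs c k * t ^ k"
      by (simp add: sum_divide_distrib sum_distrib_right mult.assoc)
  qed
  finally show ?thesis
    using d unfolding eq by (simp add: sums_iff)
qed

lemma has_vector_derivative_vecI:
  fixes f :: "real \<Rightarrow> real ^ 'n::finite"
  assumes "\<And>i. ((\<lambda>t. f t $ i) has_real_derivative f' $ i) F"
  shows "(f has_vector_derivative f') F"
proof -
  have "((\<lambda>t. \<Sum>i\<in>UNIV. f t $ i *\<^sub>R axis i (1::real)) has_vector_derivative (\<Sum>i\<in>UNIV. f' $ i *\<^sub>R axis i (1::real))) F"
    using assms
    by (intro has_vector_derivative_sum bounded_linear.has_vector_derivative[OF bounded_linear_scaleR_left])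
      (simp add: has_real_derivative_iff_has_vector_derivative)
  then show ?thesis
    unfolding scalar_mult_eq_scaleR[symmetric] basis_expansion .
qed

lemma has_vector_derivative_vecD:
  fixes f :: "real \<Rightarrow> real ^ 'n::finite"
  assumes "(f has_vector_derivative f') F"
  shows "((\<lambda>t. f t $ i) has_real_derivative f' $ i) F"
  using bounded_linear.has_vector_derivative[OF bounded_linear_vec_nth assms]
  by (simp add: has_real_derivative_iff_has_vector_derivative)

lemma mat_exp_mult_deriv:
  fixes A :: "real ^ 'n::finite ^ 'n"
  shows "((\<lambda>t. mat_exp (t *\<^sub>R A) *v v) has_vector_derivative
     (A *v (mat_exp (t *\<^sub>R A) *v v))) (at t within S)"
  by (rule has_vector_derivative_at_within[OF has_vector_derivative_vecI]) (rule mat_exp_mult_nth_deriv)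

section \<open>Forward flow\<close>

lemma flow_nth_deriv:
  fixes f :: "real \<Rightarrow> real ^ 'n::{finite,linorder}"
  assumes "(f has_vector_derivative - (ladder_gen *v f s)) F" and k: "k \<in> {1..CARD('n)}"
  shows "((\<lambda>s. f s $ idx k) has_real_derivative
    - rate CARD('n) (k - 1) * f s $ idx k + rate CARD('n) k * f s $ idx (Suc k)) F"
  using has_vector_derivative_vecD[OF assms(1), of "idx k"] k
  by (simp add: ladder_gen_mult_nth)

text \<open>Level \<open>m\<close> is fed only from level \<open>m + 1\<close>. Going down from the
  top, the inflow is already known to be nonnegative, so each coordinate stays above its initial
  value times a positive exponential.\<close>

lemma flow_nonneg:
  fixes f :: "real \<Rightarrow> real ^ 'n::{finite,linorder}"
  assumes deriv: "\<And>s. s \<in> {a..b} \<Longrightarrow>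
      (f has_vector_derivative - (ladder_gen *v f s)) (at s within {a..b})"
    and init: "\<And>i. 0 \<le> f a $ i" and s: "s \<in> {a..b}"
  shows "0 \<le> f s $ i"
proof -
  let ?n = "CARD('n)"
  \<comment> \<open>The induction starts at \<open>Suc ?n\<close>, where the claim is vacuous; the
    top level falls under the induction step, with inflow rate
    \<open>rate ?n ?n = 0\<close>.\<close>
  have "k \<le> ?n \<longrightarrow> (\<forall>s\<in>{a..b}. 0 \<le> f s $ idx k)" if "k \<in> {1..Suc ?n}" for k
  proof -
    have "k \<le> Suc ?n" using that by simp
    then show ?thesis
    proof (induction rule: inc_induct)
      case (step m)
      have m: "m \<in> {1..?n}" using step that by auto
      have "0 \<le> f s $ idx m" if s: "s \<in> {a..b}" for s
      proof -
        have "exp (- rate ?n (m - 1) * (s - a)) * f a $ idx m \<le> f s $ idx m"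
        proof (rule scalar_ode_ge)
          fix r assume r: "r \<in> {a..s}"
          show "((\<lambda>s. f s $ idx m) has_real_derivative
              - rate ?n (m - 1) * f r $ idx m + rate ?n m * f r $ idx (Suc m)) (at r within {a..s})"
            using r s by (intro flow_nth_deriv m has_vector_derivative_within_subset[OF deriv]) auto
          show "0 \<le> rate ?n m * f r $ idx (Suc m)"
          proof (cases "m = ?n")
            case False
            then show ?thesis using step.IH m r s by (intro mult_nonneg_nonneg rate_nonneg) auto
          qed simp
        qed (use s in auto)
        moreover have "0 \<le> exp (- rate ?n (m - 1) * (s - a)) * f a $ idx m"
          using init by simp
        ultimately show ?thesis by linarith
      qed
      then show ?case by blast
    qed simp
  qed
  then show ?thesis
    using s by (metis idx_cases atLeastAtMost_iff le_SucI)
qed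

text \<open>Uniqueness from positivity: by linearity \<open>f - g\<close> and \<open>g - f\<close>
  both solve the equation with initial value 0, hence both stay nonnegative.\<close>

lemma flow_eq:
  fixes f g :: "real \<Rightarrow> real ^ 'n::{finite,linorder}"
  assumes "\<And>s. s \<in> {a..b} \<Longrightarrow>
      (f has_vector_derivative - (ladder_gen *v f s)) (at s within {a..b})"
    and "\<And>s. s \<in> {a..b} \<Longrightarrow>
      (g has_vector_derivative - (ladder_gen *v g s)) (at s within {a..b})"
    and "f a = g a" and "a \<le> b"
  shows "f b = g b"
proof -
  have "0 \<le> (f b - g b) $ i" for i
    by (rule flow_nonneg[of a b "\<lambda>s. f s - g s"])
      (use assms in \<open>auto intro!: derivative_eq_intros simp: matrix_vector_mult_diff_distrib\<close>)
  moreover have "0 \<le> (g b - f b) $ i" for i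
    by (rule flow_nonneg[of a b "\<lambda>s. g s - f s"])
      (use assms in \<open>auto intro!: derivative_eq_intros simp: matrix_vector_mult_diff_distrib\<close>)
  ultimately show ?thesis
    by (auto simp: vec_eq_iff intro: antisym)
qed

lemma sum_ladder_gen_eq_0: "(\<Sum>i\<in>UNIV. (ladder_gen *v x) $ (i::'n::{finite,linorder})) = 0"
  using sum_ladder_gen[of "\<lambda>_. 1" x] by (simp add: sum_UNIV_idx)

text \<open>Conservation of mass, for the forward flow with \<open>c = -1\<close> and for the
  backward flow with \<open>c = 1\<close>.\<close>

lemma sum_const_of_deriv:
  fixes f :: "real \<Rightarrow> real ^ 'n::{finite,linorder}"
  assumes "\<And>s. s \<in> {a..b} \<Longrightarrow>
      (f has_vector_derivative c *\<^sub>R (ladder_gen *v f s)) (at s within {a..b})"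
    and "a \<le> b"
  shows "(\<Sum>i\<in>UNIV. f b $ i) = (\<Sum>i\<in>UNIV. f a $ i)"
proof -
  \<comment> \<open>The zero derivative is written as a multiple of the sum to match
    \<open>scalar_ode_eq\<close> with rate 0.\<close>
  have "((\<lambda>s. \<Sum>i\<in>UNIV. f s $ i) has_real_derivative 0 * (\<Sum>i\<in>UNIV. f s $ i)) (at s within {a..b})"
    if "s \<in> {a..b}" for s
  proof -
    have "((\<lambda>s. \<Sum>i\<in>UNIV. f s $ i) has_real_derivative
        (\<Sum>i\<in>UNIV. (c *\<^sub>R (ladder_gen *v f s)) $ i)) (at s within {a..b})"
      by (intro DERIV_sum has_vector_derivative_vecD assms(1) that)
    then show ?thesis
      by (simp add: sum_ladder_gen_eq_0 flip: sum_distrib_left)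
  qed
  from scalar_ode_eq[OF \<open>a \<le> b\<close> this] show ?thesis by simp
qed

lemma flow_std_simplex:
  fixes f :: "real \<Rightarrow> real ^ 'n::{finite,linorder}"
  assumes deriv: "\<And>s. s \<in> {a..b} \<Longrightarrow>
      (f has_vector_derivative - (ladder_gen *v f s)) (at s within {a..b})"
    and "f a \<in> std_simplex" and "a \<le> b"
  shows "f b \<in> std_simplex"
  using flow_nonneg[OF deriv] sum_const_of_deriv[of a b f "-1"] assms
  by (simp add: std_simplex_def)

lemma mat_exp_flow_deriv:
  fixes B :: "real ^ 'n::finite ^ 'n"
  shows "((\<lambda>t. mat_exp (- (t *\<^sub>R B)) *v v) has_vector_derivative
     - (B *v (mat_exp (- (t *\<^sub>R B)) *v v))) (at t within S)"
proof -
  have "- B *v w = - (B *v w)" for w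
    by (simp add: vec_eq_iff matrix_vector_mult_def sum_negf)
  then show ?thesis
    using mat_exp_mult_deriv[of "- B" v t S] by simp
qed

lemma mat_exp_std_simplex:
  "x \<in> std_simplex \<Longrightarrow> 0 \<le> t \<Longrightarrow> mat_exp (- (t *\<^sub>R ladder_gen)) *v x \<in> std_simplex"
  by (rule flow_std_simplex[of 0 t "\<lambda>t. mat_exp (- (t *\<^sub>R ladder_gen)) *v x"])
    (auto intro: mat_exp_flow_deriv)

text \<open>By summation by parts the height decreases at the speed obtained by replacing each
  weight \<open>k - 1\<close> with \<open>rate n (k - 1)\<close>, which is at least as large by
  \<open>rate_ge\<close>.\<close>

lemma flow_height_decay:
  fixes f :: "real \<Rightarrow> real ^ 'n::{finite,linorder}"
  assumes deriv: "\<And>s. s \<in> {a..b} \<Longrightarrow>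
      (f has_vector_derivative - (ladder_gen *v f s)) (at s within {a..b})"
    and init: "\<And>i. 0 \<le> f a $ i" and "a \<le> b"
  shows "(\<Sum>k=1..CARD('n). real (k - 1) * f b $ idx k) \<le>
    exp (- (b - a)) * (\<Sum>k=1..CARD('n). real (k - 1) * f a $ idx k)"
proof -
  let ?n = "CARD('n)"
  define L where "L x = (\<Sum>k=1..?n. real (k - 1) * x $ idx k)" for x :: "real ^ 'n::{finite,linorder}"
  \<comment> \<open>The excess of the true speed of decrease over \<open>L\<close>. As
    \<open>scalar_ode_ge\<close> bounds from below, it is applied to \<open>- L\<close> with
    \<open>g\<close> as source term.\<close>
  define g where "g s = (\<Sum>k=1..?n. rate ?n (k - 1) * f s $ idx k) - L (f s)" for s
  have "exp (- 1 * (b - a)) * (- L (f a)) \<le> - L (f b)"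
  proof (rule scalar_ode_ge[OF \<open>a \<le> b\<close>])
    fix s assume s: "s \<in> {a..b}"
    have "((\<lambda>s. - L (f s)) has_real_derivative
      - (\<Sum>k=1..?n. real (k - 1) * (- (ladder_gen *v f s)) $ idx k)) (at s within {a..b})"
      unfolding L_def
      by (intro DERIV_minus DERIV_sum DERIV_cmult has_vector_derivative_vecD deriv s)
    moreover have "- (\<Sum>k=1..?n. real (k - 1) * (- (ladder_gen *v f s)) $ idx k) =
        (\<Sum>k=1..?n. (real (k - 1) - real (k - 1 - 1)) * rate ?n (k - 1) * f s $ idx k)"
      by (subst sum_ladder_gen[symmetric]) (simp add: sum_negf)
    moreover have "\<dots> = (\<Sum>k=1..?n. rate ?n (k - 1) * f s $ idx k)"
    proof (intro sum.cong refl)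
      fix k assume "k \<in> {1..?n}"
      \<comment> \<open>At \<open>k = 1\<close> truncated subtraction makes the difference of
        weights 0 instead of 1, but \<open>rate ?n 0 = 0\<close> as well.\<close>
      then show "(real (k - 1) - real (k - 1 - 1)) * rate ?n (k - 1) * f s $ idx k =
          rate ?n (k - 1) * f s $ idx k"
        by (cases "k = 1") (auto simp: of_nat_diff)
    qed
    ultimately show "((\<lambda>s. - L (f s)) has_real_derivative - 1 * - L (f s) + g s) (at s within {a..b})"
      by (simp add: g_def)
    show "0 \<le> g s"
      unfolding g_def L_def
      using flow_nonneg[OF deriv init s]
      by (auto intro!: sum_mono mult_right_mono rate_ge simp del: of_nat_diff)
  qed
  then show ?thesis by (simp add: L_def)
qed

text \<open>On the simplex the mean height bounds the deviation of every coordinate from the lowest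
  vertex, since all levels but the lowest have weight at least 1.\<close>

lemma mat_exp_tendsto_idx_1:
  fixes x :: "real ^ 'n::{finite,linorder}"
  assumes "x \<in> std_simplex"
  shows "((\<lambda>t. mat_exp (- (t *\<^sub>R ladder_gen)) *v x) \<longlongrightarrow> axis (idx 1) 1) at_top"
proof (rule vec_tendstoI)
  fix i :: 'n
  let ?n = "CARD('n)"
  define y where "y t = mat_exp (- (t *\<^sub>R ladder_gen)) *v x" for t
  define L where "L x = (\<Sum>k=1..?n. real (k - 1) * x $ idx k)" for x :: "real ^ 'n::{finite,linorder}"
  obtain m where m: "m \<in> {1..?n}" "i = idx m" by (rule idx_cases)
  have n: "1 \<in> {1..?n}" using m by auto
  have "norm (y t $ i - axis (idx 1) 1 $ i) \<le> exp (- t) * L x" if "0 \<le> t" for t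
  proof -
    have y: "0 \<le> y t $ j" "(\<Sum>k=1..?n. y t $ idx k) = 1" for j
      using mat_exp_std_simplex[OF assms that]
      by (simp_all add: std_simplex_def y_def sum_UNIV_idx)
    have le: "y t $ j \<le> real (k - 1) * y t $ j" if "2 \<le> k" for k j
      using mult_right_mono[of 1 "real (k - 1)" "y t $ j"] that y(1) by simp
    \<comment> \<open>At the lowest level the deviation is the total mass of the other levels;
      elsewhere it is bounded by one term of the height.\<close>
    have "norm (y t $ i - axis (idx 1) 1 $ i) \<le> L (y t)"
    proof (cases "m = 1")
      case True
      have "1 - y t $ idx 1 = (\<Sum>k=1..?n. y t $ idx k - (if k = 1 then y t $ idx k else 0))"
        using n y(2) by (simp add: sum_subtractf)
      also have "\<dots> \<le> L (y t)"
        unfolding L_def by (intro sum_mono) (use le in auto)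
      finally have "1 - y t $ idx 1 \<le> L (y t)" .
      moreover have "y t $ idx 1 \<le> (\<Sum>k=1..?n. y t $ idx k)"
        using n y(1) by (intro member_le_sum) auto
      ultimately show ?thesis using True m y(2) by (simp add: axis_def)
    next
      case False
      have "real (m - 1) * y t $ idx m \<le> L (y t)"
        unfolding L_def using m y(1) by (intro member_le_sum) auto
      moreover have "y t $ idx m \<le> real (m - 1) * y t $ idx m"
        using False m by (intro le) auto
      ultimately show ?thesis using False m n y(1) by (auto simp: axis_def idx_eq_iff)
    qed
    also have "\<dots> \<le> exp (- (t - 0)) * L (y 0)"
      unfolding L_def using that assms
      by (intro flow_height_decay) (auto simp: y_def std_simplex_def intro!: mat_exp_flow_deriv)
    finally show ?thesis by (simp add: y_def)
  qed
  then have "\<forall>\<^sub>F t in at_top. norm (y t $ i - axis (idx 1) 1 $ i) \<le> exp (- t) * L x"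
    by (auto simp: eventually_at_top_linorder)
  moreover have "((\<lambda>t. exp (- t) * L x) \<longlongrightarrow> 0) at_top"
    by (intro tendsto_mult_left_zero filterlim_compose[OF exp_at_bot] filterlim_uminus_at_bot_at_top)
  ultimately have "((\<lambda>t. y t $ i - axis (idx 1) 1 $ i) \<longlongrightarrow> 0) at_top"
    by (rule Lim_null_comparison)
  then show "((\<lambda>t. (mat_exp (- (t *\<^sub>R ladder_gen)) *v x) $ i) \<longlongrightarrow> axis (idx 1) 1 $ i) at_top"
    unfolding y_def by (rule LIM_zero_cancel)
qed

section \<open>Backward flow\<close>

lemma continuous_on_Min:
  fixes f :: "'i \<Rightarrow> 'a::topological_space \<Rightarrow> 'b::linorder_topology"
  assumes "finite I" "I \<noteq> {}" "\<And>i. i \<in> I \<Longrightarrow> continuous_on S (f i)"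
  shows "continuous_on S (\<lambda>x. Min ((\<lambda>i. f i x) ` I))"
  using assms
proof (induction I rule: finite_ne_induct)
  case (insert i I)
  then show ?case by (auto intro!: continuous_on_min)
qed simp

lemma backward_nth_deriv:
  fixes f :: "real \<Rightarrow> real ^ 'n::{finite,linorder}"
  assumes "(f has_vector_derivative ladder_gen *v f s) F" and k: "k \<in> {1..CARD('n)}"
  shows "((\<lambda>s. f s $ idx k) has_real_derivative
    rate CARD('n) (k - 1) * f s $ idx k - rate CARD('n) k * f s $ idx (Suc k)) F"
  using has_vector_derivative_vecD[OF assms(1), of "idx k"] k
  by (simp add: ladder_gen_mult_nth)

lemma backward_nth_eq:
  fixes f :: "real \<Rightarrow> real ^ 'n::{finite,linorder}"
  assumes deriv: "\<And>s. s \<in> {a..b} \<Longrightarrow>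
      (f has_vector_derivative ladder_gen *v f s) (at s within {a..b})"
    and k: "k \<in> {1..CARD('n)}" and b: "a \<le> b"
    and zero: "\<And>s. s \<in> {a..b} \<Longrightarrow> rate CARD('n) k * f s $ idx (Suc k) = 0"
  shows "f b $ idx k = exp (rate CARD('n) (k - 1) * (b - a)) * f a $ idx k"
proof (rule scalar_ode_eq[OF b])
  show "((\<lambda>s. f s $ idx k) has_real_derivative rate CARD('n) (k - 1) * f s $ idx k)
      (at s within {a..b})" if "s \<in> {a..b}" for s
    using backward_nth_deriv[OF deriv[OF that] k] zero[OF that] by simp
qed

text \<open>A level is driven only by itself and the level above, so, descending from the top,
  levels that start at 0 remain there.\<close>

lemma backward_zero:
  fixes f :: "real \<Rightarrow> real ^ 'n::{finite,linorder}"
  assumes deriv: "\<And>s. s \<in> {a..b} \<Longrightarrow>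
      (f has_vector_derivative ladder_gen *v f s) (at s within {a..b})"
    and zero: "\<And>k. k \<in> {m<..CARD('n)} \<Longrightarrow> f a $ idx k = 0"
    and k: "k \<in> {m<..CARD('n)}" and s: "s \<in> {a..b}"
  shows "f s $ idx k = 0"
proof -
  let ?n = "CARD('n)"
  have "k \<le> Suc ?n" using k by simp
  then have "m < k \<and> k \<le> ?n \<longrightarrow> (\<forall>s\<in>{a..b}. f s $ idx k = 0)"
  proof (induction rule: inc_induct)
    case (step j)
    show ?case
    proof (intro impI ballI)
      fix s assume j: "m < j \<and> j \<le> ?n" and s: "s \<in> {a..b}"
      have "f s $ idx j = exp (rate ?n (j - 1) * (s - a)) * f a $ idx j"
      proof (rule backward_nth_eq)
        fix r assume r: "r \<in> {a..s}"
        show "(f has_vector_derivative ladder_gen *v f r) (at r within {a..s})"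
          using r s by (intro has_vector_derivative_within_subset[OF deriv]) auto
        show "rate ?n j * f r $ idx (Suc j) = 0"
          using step.IH r s j by (cases "j = ?n") auto
      qed (use j s in auto)
      then show "f s $ idx j = 0" using zero j by simp
    qed
  qed simp
  with k s show ?thesis by auto
qed

text \<open>For \<open>m \<ge> 2\<close> the mass at level \<open>m\<close> grows at the positive
  rate \<open>rate n (m - 1)\<close>; for \<open>m = 1\<close> the state would be the stationary
  lowest vertex.\<close>

lemma backward_exit:
  fixes z :: "real ^ 'n::{finite,linorder}"
  assumes z: "z \<in> std_simplex" and m: "m \<in> {2..CARD('n)}"
    and pos: "\<And>k. k \<in> {1..m} \<Longrightarrow> 0 < z $ idx k"
    and zero: "\<And>k. k \<in> {m<..CARD('n)} \<Longrightarrow> z $ idx k = 0"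
  obtains \<tau> z' where "0 \<le> \<tau>" "z' \<in> std_simplex" "mat_exp (- (\<tau> *\<^sub>R ladder_gen)) *v z' = z"
    "{i. z' $ i \<noteq> 0} \<subset> {i. z $ i \<noteq> 0}"
proof -
  let ?n = "CARD('n)"
  define y where "y t = mat_exp (t *\<^sub>R ladder_gen) *v z" for t
  have y0: "y 0 = z" by (simp add: y_def)
  have deriv: "(y has_vector_derivative ladder_gen *v y t) (at t within S)" for t S
    unfolding y_def by (rule mat_exp_mult_deriv)
  have sum1: "(\<Sum>i\<in>UNIV. y t $ i) = 1" if "0 \<le> t" for t
    using sum_const_of_deriv[of 0 t y 1] deriv that z y0 by (simp add: std_simplex_def)
  have y_zero: "y t $ idx k = 0" if "0 \<le> t" "k \<in> {m<..?n}" for t k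
    by (rule backward_zero[of 0 t y m]) (use deriv that zero y0 in auto)
  have y_top: "y t $ idx m = exp (rate ?n (m - 1) * t) * z $ idx m" if "0 \<le> t" for t
  proof -
    have "rate ?n m * y s $ idx (Suc m) = 0" if "s \<in> {0..t}" for s
      using y_zero[of s "Suc m"] that m by (cases "m = ?n") auto
    then show ?thesis
      using backward_nth_eq[of 0 t y m] deriv that m y0 by auto
  qed
  \<comment> \<open>Any zero of this minimum serves as exit time: none of the first \<open>m\<close>
    coordinates is then negative, and at least one vanishes.\<close>
  define g where "g t = Min ((\<lambda>k. y t $ idx k) ` {1..m})" for t
  have fin: "finite ((\<lambda>k. y t $ idx k) ` {1..m})" and ne: "(\<lambda>k. y t $ idx k) ` {1..m} \<noteq> {}" for t
    using m by auto
  have "continuous_on S y" for S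
    using deriv has_vector_derivative_continuous by (blast intro: continuous_at_imp_continuous_on)
  then have cont: "continuous_on S g" for S
    unfolding g_def using m by (intro continuous_on_Min continuous_on_component) auto
  have "0 < g 0"
    unfolding g_def y0 using pos ne[of 0] y0 by (subst Min_gr_iff) auto
  \<comment> \<open>\<open>T\<close> is chosen so that the linear lower bound
    \<open>1 + r * T\<close> of the exponential adds exactly 1 to the mass at level
    \<open>m\<close>, which then exceeds the total mass.\<close>
  define r T where "r = rate ?n (m - 1)" and "T = 1 / (r * z $ idx m)"
  have r: "0 < r"
    using m by (auto simp: r_def rate_def intro!: mult_pos_pos)
  have zm: "0 < z $ idx m"
    using pos m by auto
  have T: "0 \<le> T"
    using r zm by (simp add: T_def)
  have "1 + r * T \<le> exp (r * T)"
    by (rule exp_ge_add_one_self)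
  then have "(1 + r * T) * z $ idx m \<le> y T $ idx m"
    unfolding y_top[OF T] r_def[symmetric] using zm by (intro mult_right_mono) auto
  moreover have "(1 + r * T) * z $ idx m = z $ idx m + 1"
    using r zm by (simp add: T_def field_simps)
  ultimately have big: "1 < y T $ idx m"
    using zm by linarith
  have "g T \<le> 0"
  proof (rule ccontr)
    assume "\<not> g T \<le> 0"
    then have "\<forall>k\<in>{1..m}. 0 < y T $ idx k"
      unfolding g_def using Min_gr_iff[OF fin ne] by (auto simp: not_le)
    then have "0 \<le> y T $ idx k" if "k \<in> {1..?n}" for k
      using y_zero[OF T, of k] that by (cases "k \<le> m") (auto intro: less_imp_le)
    then have "0 \<le> y T $ i" for i
      by (metis idx_cases)
    then have "y T $ idx m \<le> (\<Sum>i\<in>UNIV. y T $ i)"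
      by (intro member_le_sum) auto
    with big sum1[OF T] show False by simp
  qed
  then obtain \<tau> where \<tau>: "0 \<le> \<tau>" "g \<tau> = 0"
    using IVT2'[of g T 0 0, OF _ _ T cont] \<open>0 < g 0\<close> by auto
  have nonneg: "0 \<le> y \<tau> $ idx k" if "k \<in> {1..m}" for k
  proof -
    have "g \<tau> \<le> y \<tau> $ idx k"
      unfolding g_def using that by (intro Min_le) auto
    with \<tau>(2) show ?thesis by simp
  qed
  obtain k where k: "k \<in> {1..m}" "y \<tau> $ idx k = 0"
    using Min_in[OF fin ne, of \<tau>] \<tau>(2) by (auto simp: g_def)
  show thesis
  proof
    show "0 \<le> \<tau>" by fact
    have "0 \<le> y \<tau> $ idx k" if "k \<in> {1..?n}" for k
      using y_zero[OF \<tau>(1), of k] nonneg[of k] that by (cases "k \<le> m") auto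
    then have "0 \<le> y \<tau> $ i" for i
      by (metis idx_cases)
    then show "y \<tau> \<in> std_simplex"
      using sum1[OF \<tau>(1)] by (simp add: std_simplex_def)
    have "{i. y \<tau> $ i \<noteq> 0} \<subseteq> {i. z $ i \<noteq> 0}"
    proof
      fix i assume i: "i \<in> {i. y \<tau> $ i \<noteq> 0}"
      obtain l where l: "l \<in> {1..?n}" "i = idx l" by (rule idx_cases)
      then have "l \<le> m" using i y_zero[OF \<tau>(1), of l] by force
      then show "i \<in> {i. z $ i \<noteq> 0}" using pos[of l] l by auto
    qed
    moreover have "z $ idx k \<noteq> 0"
      using pos[OF k(1)] by simp
    ultimately show "{i. y \<tau> $ i \<noteq> 0} \<subset> {i. z $ i \<noteq> 0}"
      using k(2) by blast
    \<comment> \<open>The reversed trajectory solves the forward equation from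
      \<open>y \<tau>\<close>; uniqueness identifies it with the forward flow, which therefore
      arrives at \<open>y 0 = z\<close>.\<close>
    have "mat_exp (- (\<tau> *\<^sub>R ladder_gen)) *v y \<tau> = y (\<tau> - \<tau>)"
    proof (rule flow_eq[where a = 0 and b = \<tau> and f = "\<lambda>s. mat_exp (- (s *\<^sub>R ladder_gen)) *v y \<tau>"
          and g = "\<lambda>s. y (\<tau> - s)"])
      fix s
      have "((\<lambda>s. \<tau> - s) has_vector_derivative -1) (at s within {0..\<tau>})"
        by (auto intro!: derivative_eq_intros)
      from vector_diff_chain_within[OF this deriv]
      show "((\<lambda>s. y (\<tau> - s)) has_vector_derivative - (ladder_gen *v y (\<tau> - s))) (at s within {0..\<tau>})"
        by (simp add: comp_def)
    qed (use \<tau> mat_exp_flow_deriv in auto)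
    then show "mat_exp (- (\<tau> *\<^sub>R ladder_gen)) *v y \<tau> = z"
      by (simp add: y0)
  qed
qed

section \<open>Steering\<close>

text \<open>The matrix of a permutation \<open>p\<close> moves entry \<open>j\<close> to position
  \<open>p j\<close>; reading entries through \<open>p\<close> therefore takes the matrix of the
  inverse.\<close>

lemma permutation_matrix_mult_nth:
  fixes z :: "'a::semiring_1 ^ 'n::finite"
  assumes "p permutes UNIV"
  shows "((\<chi> i j. if i = inv p j then 1 else 0) *v z) $ i = z $ p i"
proof -
  have "i = inv p j \<longleftrightarrow> j = p i" for j
    using assms by (metis permutes_inverses)
  then show ?thesis
    by (simp add: matrix_vector_mult_def if_distrib[of "\<lambda>t. t * _"] cong: if_cong)
qed

lemma permutation_matrix_exists:
  fixes p :: "'n::finite \<Rightarrow> 'n"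
  assumes "p permutes UNIV"
  obtains P where "permutation_matrix P" "\<And>z i. (P *v z) $ i = z $ p i"
  using permutation_matrix_mult_nth[OF assms] permutes_inv[OF assms]
  unfolding permutation_matrix_def by blast

lemma permutation_matrix_std_simplex:
  assumes "permutation_matrix P" "z \<in> std_simplex"
  shows "P *v z \<in> std_simplex"
proof -
  obtain p where p: "p permutes UNIV" "P = (\<chi> i j. if i = p j then 1 else 0)"
    using assms(1) by (auto simp: permutation_matrix_def)
  have nth: "(P *v z) $ i = z $ inv p i" for i
    using permutation_matrix_mult_nth[OF permutes_inv[OF p(1)], of z i] permutes_inv_inv[OF p(1)]
    by (simp add: p(2))
  then show ?thesis
    using assms(2) sum.permute[OF permutes_inv[OF p(1)], of "\<lambda>i. z $ i"]
    by (simp add: std_simplex_def comp_def)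
qed

lemma permutation_matrix_one: "permutation_matrix (mat 1)"
  unfolding permutation_matrix_def mat_def by (rule exI[of _ id]) (simp add: permutes_id)

text \<open>Finite control words: each letter is a waiting time together with the permutation
  applied at its end. Through \<open>steer\<close> they act as the elements of the semigroup
  generated by the flow and the permutations.\<close>

definition admissible :: "(real \<times> (real ^ 'n::finite ^ 'n)) list \<Rightarrow> bool" where
  "admissible ws \<longleftrightarrow> (\<forall>(\<tau>, P)\<in>set ws. 0 \<le> \<tau> \<and> permutation_matrix P)"

definition steer :: "real ^ 'n::finite ^ 'n \<Rightarrow> (real \<times> (real ^ 'n ^ 'n)) list \<Rightarrow> real ^ 'n \<Rightarrow> real ^ 'n" where
  "steer B ws x = foldl (\<lambda>x (\<tau>, P). P *v (mat_exp (- (\<tau> *\<^sub>R B)) *v x)) x ws"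

lemma steer_simps [simp]:
  "steer B [] x = x"
  "steer B ((\<tau>, P) # ws) x = steer B ws (P *v (mat_exp (- (\<tau> *\<^sub>R B)) *v x))"
  "steer B (vs @ ws) x = steer B ws (steer B vs x)"
  by (simp_all add: steer_def)

lemma continuous_on_steer: "continuous_on S (steer B ws)"
proof (induction ws arbitrary: S)
  case (Cons w ws)
  obtain \<tau> P where w: "w = (\<tau>, P)" by (cases w)
  have "continuous_on S (\<lambda>x. steer B ws (P *v (mat_exp (- (\<tau> *\<^sub>R B)) *v x)))"
    by (rule continuous_on_compose2[OF Cons[of UNIV]])
      (auto intro!: matrix_vector_mult_linear_continuous_on continuous_on_compose2[of UNIV "(*v) P"])
  then show ?case by (simp add: w)
qed simp

lemma steer_in_toy_reach:
  fixes B :: "real ^ 'n::finite ^ 'n"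
  assumes "admissible ws"
  shows "steer B ws x\<^sub>0 \<in> toy_reach B x\<^sub>0"
proof -
  let ?N = "length ws"
  \<comment> \<open>Padding with unit waiting times keeps the switching times from accumulating and
    makes the interval after the last letter nonempty, so that the trajectory really takes the value
    reached by the word.\<close>
  define \<tau> \<pi> where "\<tau> k = (if k < ?N then fst (ws ! k) else 1)"
    and "\<pi> k = (if k < ?N then snd (ws ! k) else mat 1)" for k
  have \<tau>: "0 \<le> \<tau> k" and \<pi>: "permutation_matrix (\<pi> k)" for k
    using assms nth_mem[of k ws] permutation_matrix_one
    by (fastforce simp: \<tau>_def \<pi>_def admissible_def)+
  define t where "t k = (\<Sum>j<k. \<tau> j)" for k
  have t_Suc: "t (Suc k) = t k + \<tau> k" for k
    by (simp add: t_def)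
  have mono: "mono t"
    using \<tau> by (simp add: mono_iff_le_Suc t_Suc)
  have t_ge: "real j \<le> t (?N + j)" for j
  proof (induction j)
    case 0
    show ?case using \<tau> by (auto simp: t_def intro!: sum_nonneg)
  next
    case (Suc j)
    then show ?case by (simp add: t_Suc \<tau>_def)
  qed
  have "finite {k. t k \<le> T}" for T
  proof -
    obtain j where "T < real j" using reals_Archimedean2 by blast
    then have "T < t (?N + j)" using t_ge[of j] by linarith
    then have "k < ?N + j" if "t k \<le> T" for k
      using monoD[OF mono, of "?N + j" k] that by (meson leI le_less_trans order_trans not_less)
    then have "{k. t k \<le> T} \<subseteq> {..<?N + j}" by auto
    then show ?thesis by (rule finite_subset) simp
  qed
  then have switching: "switching_times t"
    using mono by (simp add: switching_times_def t_def)
  define \<xi> where "\<xi> = rec_nat x\<^sub>0 (\<lambda>k v. \<pi> k *v (mat_exp (- (\<tau> k *\<^sub>R B)) *v v))"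
  have \<xi>: "\<xi> 0 = x\<^sub>0" "\<xi> (Suc k) = \<pi> k *v (mat_exp (- (\<tau> k *\<^sub>R B)) *v \<xi> k)" for k
    by (simp_all add: \<xi>_def)
  have "\<xi> k = steer B (take k ws) x\<^sub>0" if "k \<le> ?N" for k
    using that
  proof (induction k)
    case (Suc k)
    then have "take (Suc k) ws = take k ws @ [(\<tau> k, \<pi> k)]"
      by (simp add: take_Suc_conv_app_nth \<tau>_def \<pi>_def)
    with Suc show ?case by (simp add: \<xi>(2))
  qed (simp add: \<xi>)
  then have \<xi>_N: "\<xi> ?N = steer B ws x\<^sub>0" by simp
  \<comment> \<open>The least such index skips the empty intervals of coinciding switching times;
    for \<open>s \<ge> 0\<close> it names the interval that contains \<open>s\<close>.\<close>
  define \<kappa> where "\<kappa> s = (LEAST k. s < t (Suc k))" for s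
  have \<kappa>: "\<kappa> s = k" if "s \<in> {t k..<t (Suc k)}" for s k
    unfolding \<kappa>_def
  proof (rule Least_equality)
    show "s < t (Suc k)" using that by simp
    show "k \<le> j" if "s < t (Suc j)" for j
    proof (rule ccontr)
      assume "\<not> k \<le> j"
      then have "t (Suc j) \<le> t k" by (intro monoD[OF mono]) simp
      then show False using that \<open>s \<in> {t k..<t (Suc k)}\<close> by simp
    qed
  qed
  define x where "x s = mat_exp (- ((s - t (\<kappa> s)) *\<^sub>R B)) *v \<xi> (\<kappa> s)" for s
  have x_eq: "x s = mat_exp (- ((s - t k) *\<^sub>R B)) *v \<xi> k" if "s \<in> {t k..<t (Suc k)}" for s k
    using \<kappa>[OF that] by (simp add: x_def)
  have x_t: "x (t k) = \<xi> k" if "t k < t (Suc k)" for k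
    using that by (subst x_eq[of _ k]) auto
  have "(x has_vector_derivative - (B *v x s)) (at s within {t k..<t (Suc k)})"
    if s: "s \<in> {t k..<t (Suc k)}" for s k
  proof -
    have "((\<lambda>s. s - t k) has_vector_derivative 1) (at s within {t k..<t (Suc k)})"
      by (auto intro!: derivative_eq_intros)
    from vector_diff_chain_within[OF this mat_exp_flow_deriv[of B "\<xi> k"]]
    have "((\<lambda>s. mat_exp (- ((s - t k) *\<^sub>R B)) *v \<xi> k) has_vector_derivative - (B *v x s))
        (at s within {t k..<t (Suc k)})"
      by (simp add: comp_def x_eq[OF s])
    then show ?thesis
      by (rule has_vector_derivative_transform[OF s, rotated]) (simp add: x_eq)
  qed
  then have "toy_solution B x\<^sub>0 t \<pi> x"
    unfolding toy_solution_def using switching \<pi> \<xi> x_t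
    by (intro conjI exI[of _ \<xi>]) (auto simp: t_Suc)
  moreover have "x (t ?N) = steer B ws x\<^sub>0"
    using x_t[of ?N] \<xi>_N by (simp add: t_Suc \<tau>_def)
  moreover have "0 \<le> t ?N"
    using t_ge[of 0] by simp
  ultimately show ?thesis
    unfolding toy_reach_def by (metis (mono_tags, lifting) mem_Collect_eq)
qed

text \<open>Flow and permutations preserve the simplex, hence so do the states \<xi>; from the last
  switching time on, the differential equation is followed.\<close>

lemma toy_reach_subset_std_simplex:
  fixes x\<^sub>0 :: "real ^ 'n::{finite,linorder}"
  assumes "x\<^sub>0 \<in> std_simplex"
  shows "toy_reach ladder_gen x\<^sub>0 \<subseteq> std_simplex"
proof
  fix y assume "y \<in> toy_reach ladder_gen x\<^sub>0"
  then obtain s t \<pi> x where sol: "toy_solution ladder_gen x\<^sub>0 t \<pi> x" and s: "0 \<le> s" and y: "y = x s"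
    by (auto simp: toy_reach_def)
  obtain \<xi> where sw: "switching_times t" and \<pi>: "\<And>k. permutation_matrix (\<pi> k)"
    and \<xi>: "\<xi> 0 = x\<^sub>0" "\<And>k. \<xi> (Suc k) = \<pi> k *v (mat_exp (- ((t (Suc k) - t k) *\<^sub>R ladder_gen)) *v \<xi> k)"
    and x: "\<And>k. t k < t (Suc k) \<Longrightarrow> x (t k) = \<xi> k"
    and deriv: "\<And>k s. t k < t (Suc k) \<Longrightarrow> s \<in> {t k..<t (Suc k)} \<Longrightarrow>
      (x has_vector_derivative - (ladder_gen *v x s)) (at s within {t k..<t (Suc k)})"
    using sol unfolding toy_solution_def by blast
  have t: "t 0 = 0" "mono t" "finite {k. t k \<le> s}"
    using sw by (auto simp: switching_times_def)
  have \<xi>_simplex: "\<xi> k \<in> std_simplex" for k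
  proof (induction k)
    case (Suc k)
    then show ?case
      using monoD[OF t(2), of k "Suc k"] \<pi>
      by (auto simp: \<xi>(2) intro!: permutation_matrix_std_simplex mat_exp_std_simplex)
  qed (simp add: \<xi>(1) assms)
  \<comment> \<open>The largest index has \<open>s < t (Suc k)\<close>, so its interval is nonempty
    and the trajectory is constrained there.\<close>
  define k where "k = Max {k. t k \<le> s}"
  have "k \<in> {k. t k \<le> s}"
    unfolding k_def using t s by (intro Max_in) (auto intro: exI[of _ 0])
  moreover have "Suc k \<notin> {k. t k \<le> s}"
    using Max_ge[OF t(3), of "Suc k"] by (auto simp: k_def)
  ultimately have k: "t k \<le> s" "s < t (Suc k)" by auto
  have "x s \<in> std_simplex"
  proof (rule flow_std_simplex[of "t k" s])
    show "(x has_vector_derivative - (ladder_gen *v x r)) (at r within {t k..s})"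
      if "r \<in> {t k..s}" for r
      using that k by (intro has_vector_derivative_within_subset[OF deriv[of k]]) auto
    show "x (t k) \<in> std_simplex"
      using x[of k] k \<xi>_simplex by simp
  qed (use k in simp)
  then show "y \<in> std_simplex" by (simp add: y)
qed

text \<open>A bijection of \<open>A\<close> onto \<open>B\<close> is glued to one between the
  complements, which have equal cardinality by finiteness.\<close>

lemma permutes_image_exists:
  fixes A B :: "'a::finite set"
  assumes "card A = card B"
  obtains p where "p permutes UNIV" "p ` A = B"
proof -
  obtain f where f: "bij_betw f A B"
    using finite_same_card_bij[OF _ _ assms] by auto
  have "card (- A) = card (- B)"
    using assms by (simp add: Compl_eq_Diff_UNIV card_Diff_subset)
  then obtain g where g: "bij_betw g (- A) (- B)"
    using finite_same_card_bij[of "- A" "- B"] by auto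
  define p where "p x = (if x \<in> A then f x else g x)" for x
  have "bij_betw p A B"
    using f by (subst bij_betw_cong[of A p f]) (auto simp: p_def)
  moreover have "bij_betw p (- A) (- B)"
    using g by (subst bij_betw_cong[of "- A" p g]) (auto simp: p_def)
  ultimately have "bij_betw p (A \<union> - A) (B \<union> - B)"
    by (rule bij_betw_combine) auto
  then have "p permutes UNIV"
    by (intro bij_imp_permutes) auto
  with \<open>bij_betw p A B\<close> show thesis
    by (intro that) (auto simp: bij_betw_def)
qed

text \<open>The word is found from its end: \<open>backward_exit\<close> yields a predecessor of
  smaller support, to which the induction hypothesis applies.\<close>

lemma steer_from_idx_1:
  fixes z :: "real ^ 'n::{finite,linorder}"
  assumes "z \<in> std_simplex"
  shows "\<exists>ws. admissible ws \<and> steer ladder_gen ws (axis (idx 1) 1) = z"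
  using assms
proof (induction "card {i. z $ i \<noteq> 0}" arbitrary: z rule: less_induct)
  case less
  let ?n = "CARD('n)"
  define U where "U = {i. z $ i \<noteq> 0}"
  define m where "m = card U"
  have "U \<noteq> {}"
  proof
    assume "U = {}"
    then have "z $ i = 0" for i by (auto simp: U_def)
    with less.prems show False by (simp add: std_simplex_def)
  qed
  then have m: "m \<in> {1..?n}"
    by (auto simp: m_def Suc_le_eq card_gt_0_iff intro: card_mono)
  have inj: "inj_on (idx :: nat \<Rightarrow> 'n) {1..m}"
    using bij_betw_imp_inj_on[OF bij_betw_idx] by (rule inj_on_subset) (use m in auto)
  then have "card ((idx :: nat \<Rightarrow> 'n) ` {1..m}) = card U"
    by (simp add: card_image m_def)
  then obtain p where p: "p permutes UNIV" "p ` idx ` {1..m} = U"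
    by (rule permutes_image_exists)
  \<comment> \<open>\<open>P\<close> moves the support to the lowest \<open>m\<close> levels, and
    \<open>Q\<close> undoes this at the end of the word.\<close>
  obtain P Q where P: "permutation_matrix P" "\<And>z i. (P *v z) $ i = z $ p i"
    and Q: "permutation_matrix Q" "\<And>z i. (Q *v z) $ i = z $ inv p i"
    using permutation_matrix_exists[OF p(1)] permutation_matrix_exists[OF permutes_inv[OF p(1)]]
    by metis
  define v where "v = P *v z"
  have v: "v \<in> std_simplex"
    unfolding v_def by (rule permutation_matrix_std_simplex[OF P(1) less.prems])
  have z_eq: "z = Q *v v"
    using p(1) by (simp add: v_def vec_eq_iff P(2) Q(2) permutes_inverses)
  have supp: "v $ idx k \<noteq> 0 \<longleftrightarrow> k \<in> {1..m}" if "k \<in> {1..?n}" for k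
  proof -
    have "v $ idx k \<noteq> 0 \<longleftrightarrow> p (idx k) \<in> p ` idx ` {1..m}"
      unfolding p(2) by (simp add: v_def P(2) U_def)
    also have "\<dots> \<longleftrightarrow> (idx k :: 'n) \<in> idx ` {1..m}"
      using permutes_inj[OF p(1)] by (simp add: inj_image_mem_iff)
    also have "\<dots> \<longleftrightarrow> k \<in> {1..m}"
      by (rule inj_on_image_mem_iff[OF bij_betw_imp_inj_on[OF bij_betw_idx] that]) (use m in auto)
    finally show ?thesis .
  qed
  have card_v: "card {i. v $ i \<noteq> 0} = card {i. z $ i \<noteq> 0}"
  proof -
    have "{i. v $ i \<noteq> 0} = inv p ` U"
      using p(1) by (force simp: v_def P(2) U_def permutes_inverses image_iff)
    then show ?thesis
      using permutes_inj[OF permutes_inv[OF p(1)]] by (simp add: card_image inj_on_subset U_def)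
  qed
  show ?case
  proof (cases "m = 1")
    case True
    have "v $ i = axis (idx 1) 1 $ i" for i
    proof -
      obtain k where k: "k \<in> {1..?n}" "i = idx k" by (rule idx_cases)
      have "(\<Sum>j=1..?n. v $ idx j) = (\<Sum>j=1..?n. if j = 1 then v $ idx j else 0)"
        using supp True by (intro sum.cong) auto
      then have "v $ idx 1 = 1"
        using v m by (simp add: std_simplex_def sum_UNIV_idx)
      then show ?thesis
        using k supp[of k] True m by (auto simp: axis_def idx_eq_iff)
    qed
    then have "v = axis (idx 1) 1" by (simp add: vec_eq_iff)
    then show ?thesis
      using Q(1) z_eq by (intro exI[of _ "[(0, Q)]"]) (simp add: admissible_def)
  next
    case False
    have "0 < v $ idx k" if "k \<in> {1..m}" for k
      using v supp[of k] that m by (auto simp: std_simplex_def order_less_le)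
    moreover have "v $ idx k = 0" if "k \<in> {m<..?n}" for k
      using supp[of k] that by auto
    moreover have "m \<in> {2..?n}"
      using m False by auto
    ultimately obtain \<tau> w where w: "0 \<le> \<tau>" "w \<in> std_simplex"
      "mat_exp (- (\<tau> *\<^sub>R ladder_gen)) *v w = v" "{i. w $ i \<noteq> 0} \<subset> {i. v $ i \<noteq> 0}"
      using backward_exit[OF v, of m] by blast
    have "card {i. w $ i \<noteq> 0} < card {i. z $ i \<noteq> 0}"
      using psubset_card_mono[OF _ w(4)] card_v by simp
    from less.hyps[OF this w(2)]
    obtain ws where "admissible ws" "steer ladder_gen ws (axis (idx 1) 1) = w" by blast
    \<comment> \<open>After reaching \<open>w\<close>, waiting for time \<tau> leads to
      \<open>v\<close>, and \<open>Q\<close> turns \<open>v\<close> into \<open>z\<close>.\<close>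
    then show ?thesis
      using Q(1) z_eq w by (intro exI[of _ "ws @ [(\<tau>, Q)]"]) (auto simp: admissible_def)
  qed
qed

lemma closed_std_simplex: "closed std_simplex"
  unfolding std_simplex_def
  by (intro closed_Collect_conj closed_Collect_all closed_Collect_le closed_Collect_eq
      continuous_intros)

theorem theorem1:
  fixes x\<^sub>0 :: "real ^ 'n::{finite,linorder}"
  assumes "x\<^sub>0 \<in> std_simplex"
  shows "closure (toy_reach (diag_rep (gksl [sigma_plus])) x\<^sub>0) = std_simplex"
proof -
  have rep: "diag_rep (gksl [sigma_plus]) = (ladder_gen :: real ^ 'n::{finite,linorder} ^ 'n::{finite,linorder})"
    by (rule diag_rep_eqI) (rule gksl_sigma_plus_diag_mat)
  have "z \<in> closure (toy_reach ladder_gen x\<^sub>0)" if z: "z \<in> std_simplex" for z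
  proof -
    obtain ws where ws: "admissible ws" "steer ladder_gen ws (axis (idx 1) 1) = z"
      using steer_from_idx_1[OF z] by blast
    \<comment> \<open>Waiting for time \<open>t\<close> brings the state close to the lowest vertex;
      the fixed word \<open>ws\<close>, exact from that vertex, then ends close to \<open>z\<close>
      by continuity.\<close>
    define x where "x t = steer ladder_gen ws (mat_exp (- (t *\<^sub>R ladder_gen)) *v x\<^sub>0)" for t
    have "(x \<longlongrightarrow> z) at_top"
      unfolding x_def ws(2)[symmetric]
      using continuous_on_steer[of UNIV] mat_exp_tendsto_idx_1[OF assms]
      by (intro isCont_tendsto_compose[of _ "steer ladder_gen ws"]) (auto simp: continuous_on_eq_continuous_at)
    moreover have "x t \<in> toy_reach ladder_gen x\<^sub>0" if "0 \<le> t" for t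
      using steer_in_toy_reach[of "(t, mat 1) # ws" ladder_gen x\<^sub>0] ws(1) that permutation_matrix_one
      by (simp add: x_def admissible_def)
    then have "\<forall>\<^sub>F t in at_top. x t \<in> closure (toy_reach ladder_gen x\<^sub>0)"
      using closure_subset by (force simp: eventually_at_top_linorder)
    ultimately show ?thesis
      by (intro Lim_in_closed_set[of _ x at_top]) auto
  qed
  then show ?thesis
    unfolding rep
    using closure_minimal[OF toy_reach_subset_std_simplex[OF assms] closed_std_simplex] by auto
qed

end
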